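(* Let $A, B \in M_4(\mathbb{C})$ satisfy $\operatorname{Tr}(A) = \operatorname{Tr}(B) = 0$ and $\|A\|_F^2 + \|B\|_F^2 = \frac{1}{4}$, and suppose that there is a unitary $U \in M_4(\mathbb{C})$ such that either $B = -UA^TU^*$ or $B = -UAU^*$. Let $X = A \otimes I_4 + I_4 \otimes B \in M_{16}(\mathbb{C})$. Then $$\sigma_1(X)^2 + \sigma_2(X)^2 \leq \frac{1}{2},$$ where $\sigma_1(X) \ge \sigma_2(X)$ are the largest and second-largest singular values of $X$.
   Context: $\|\cdot\|_F$ denotes the Frobenius norm, $\|A\|_F = (\operatorname{Tr}(A^*A))^{1/2}$. $\otimes$ denotes the Kronecker product and $A^T$ the transpose of $A$. *)

theory Defs
  imports "Jordan_Normal_Form.Schur_Decomposition" "HOL-Library.Multiset"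
begin

definition mat_trace :: "'a :: comm_ring_1 mat \<Rightarrow> 'a" where
  "mat_trace A = (\<Sum>i<dim_row A. A $$ (i, i))"

definition frob_norm :: "complex mat \<Rightarrow> real" where
  "frob_norm A = sqrt (Re (mat_trace (mat_adjoint A * A)))"

definition kron_mat :: "'a :: times mat \<Rightarrow> 'a mat \<Rightarrow> 'a mat" where
  "kron_mat A B = mat (dim_row A * dim_row B) (dim_col A * dim_col B)
     (\<lambda>(r, c). A $$ (r div dim_row B, c div dim_col B) * B $$ (r mod dim_row B, c mod dim_col B))"

definition unitary_mat :: "nat \<Rightarrow> complex mat \<Rightarrow> bool" where
  "unitary_mat n U \<longleftrightarrow> U \<in> carrier_mat n n \<and> U * mat_adjoint U = 1\<^sub>m n"

definition singular_values :: "complex mat \<Rightarrow> real list" where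
  "singular_values X = rev (sorted_list_of_multiset
      (image_mset (\<lambda>z. sqrt (Re z)) (proots (char_poly (mat_adjoint X * X)))))"

definition sigma :: "complex mat \<Rightarrow> nat \<Rightarrow> real" where
  "sigma X k = singular_values X ! (k - 1)"

end

theory Submission
  imports Defs "HOL-Computational_Algebra.Fundamental_Theorem_Algebra" "HOL-Analysis.L2_Norm"
begin

text \<open>
  Reading vectors of length 16 as \<open>4 \<times> 4\<close> matrices, \<open>X\<close> acts as \<open>N \<mapsto> A N - N F\<close>, where \<open>F = - B\<^sup>T\<close> is
  unitarily similar to \<open>A\<close> or to \<open>A\<^sup>T\<close>. It suffices to show the Boettcher--Wenzel type inequality
  \<open>\<parallel>A N - N F\<parallel>\<^sup>2 \<le> 2 \<parallel>A\<parallel>\<^sup>2 \<parallel>N\<parallel>\<^sup>2\<close>: as \<open>\<parallel>A\<parallel>\<^sup>2 = \<parallel>B\<parallel>\<^sup>2 = 1/8\<close>, it bounds the square of every singular value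
  by \<open>1/4\<close>.

  Following Audenaert, cyclicity of the trace gives
  \<open>\<parallel>A N - N F\<parallel>\<^sup>2 + \<parallel>A* N + N F*\<parallel>\<^sup>2 = tr ((A* A + A A*) D)\<close> with a positive semidefinite \<open>D\<close> of trace
  \<open>2 \<parallel>N\<parallel>\<^sup>2\<close>, and Cauchy--Schwarz gives \<open>\<parallel>A* N + N F*\<parallel> \<parallel>N\<parallel> \<ge> \<bar>tr (A* D)\<bar>\<close>. What remains is a bound for the
  variance of \<open>A\<close> in the state \<open>D\<close>, which becomes elementary once \<open>D\<close> is diagonalized.
\<close>

section \<open>Adjoints and unitary matrices\<close>

lemma mat_adjoint_carrier [simp]: "A \<in> carrier_mat n m \<Longrightarrow> mat_adjoint A \<in> carrier_mat m n"
  by (auto simp: mat_adjoint_def mat_of_rows_def)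

lemma dim_mat_adjoint [simp]:
  "dim_row (mat_adjoint A) = dim_col A" "dim_col (mat_adjoint A) = dim_row A"
  by (auto simp: mat_adjoint_def)

lemma mat_adjoint_index_dim:
  fixes A :: "complex mat"
  assumes "i < dim_col A" "j < dim_row A"
  shows "mat_adjoint A $$ (i, j) = cnj (A $$ (j, i))"
  using assms by (auto simp: mat_adjoint_def mat_of_rows_def)

lemma mat_adjoint_index:
  fixes A :: "complex mat"
  assumes "A \<in> carrier_mat n m" "i < m" "j < n"
  shows "mat_adjoint A $$ (i, j) = cnj (A $$ (j, i))"
  using assms by (auto simp: mat_adjoint_def mat_of_rows_def)

lemma mult_mat_index:
  assumes "A \<in> carrier_mat n m" "B \<in> carrier_mat m p" "i < n" "j < p"
  shows "(A * B) $$ (i, j) = (\<Sum>k<m. A $$ (i, k) * B $$ (k, j))"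
  using assms by (auto simp: scalar_prod_def lessThan_atLeast0 intro!: sum.cong)

lemma mat_adjoint_adjoint [simp]:
  fixes A :: "complex mat"
  shows "mat_adjoint (mat_adjoint A) = A"
  by (rule eq_matI) (auto simp: mat_adjoint_def mat_of_rows_def)

lemma mat_adjoint_mult:
  fixes A B :: "complex mat"
  assumes "A \<in> carrier_mat n m" "B \<in> carrier_mat m p"
  shows "mat_adjoint (A * B) = mat_adjoint B * mat_adjoint A"
proof (rule eq_matI)
  fix i j
  assume "i < dim_row (mat_adjoint B * mat_adjoint A)" "j < dim_col (mat_adjoint B * mat_adjoint A)"
  then have ij: "i < p" "j < n" using assms by (auto simp: mat_adjoint_def)
  have "mat_adjoint (A * B) $$ (i, j) = cnj (\<Sum>k<m. A $$ (j, k) * B $$ (k, i))"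
    using assms ij by (simp add: mat_adjoint_index[of _ n p] mult_mat_index[of _ n m _ p] del: index_mult_mat)
  also have "\<dots> = (\<Sum>k<m. mat_adjoint B $$ (i, k) * mat_adjoint A $$ (k, j))"
    using assms ij by (simp add: mat_adjoint_index[of A n m] mat_adjoint_index[of B m p] mult.commute)
  also have "\<dots> = (mat_adjoint B * mat_adjoint A) $$ (i, j)"
    using assms ij by (simp add: mult_mat_index[of _ p m _ n] del: index_mult_mat)
  finally show "mat_adjoint (A * B) $$ (i, j) = (mat_adjoint B * mat_adjoint A) $$ (i, j)" .
qed (use assms in \<open>auto simp: mat_adjoint_def\<close>)

lemma mat_adjoint_add:
  fixes A B :: "complex mat"
  assumes "A \<in> carrier_mat n m" "B \<in> carrier_mat n m"
  shows "mat_adjoint (A + B) = mat_adjoint A + mat_adjoint B"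
  using assms by (intro eq_matI) (auto simp: mat_adjoint_def mat_of_rows_def)

lemma mat_adjoint_minus:
  fixes A B :: "complex mat"
  assumes "A \<in> carrier_mat n m" "B \<in> carrier_mat n m"
  shows "mat_adjoint (A - B) = mat_adjoint A - mat_adjoint B"
  using assms by (intro eq_matI) (auto simp: mat_adjoint_index_dim)

lemma mat_adjoint_transpose:
  fixes A :: "complex mat"
  shows "mat_adjoint (transpose_mat A) = transpose_mat (mat_adjoint A)"
  by (intro eq_matI) (auto simp: mat_adjoint_def mat_of_rows_def)

text \<open>As rewrite rules these normalize words in square matrices: adjoints move to the factors
  and products associate to the right. One common dimension \<open>n\<close> leaves no inner
  dimension to guess.\<close>

lemmas sq_mat = mat_adjoint_mult[of _ n n _ n] assoc_mult_mat[of _ n n _ n _ n] mult_carrier_mat[of _ n n _ n] for n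

lemma unitary_matD:
  assumes "unitary_mat n U"
  shows "U \<in> carrier_mat n n" "U * mat_adjoint U = 1\<^sub>m n" "mat_adjoint U * U = 1\<^sub>m n"
proof -
  show U: "U \<in> carrier_mat n n" "U * mat_adjoint U = 1\<^sub>m n"
    using assms unfolding unitary_mat_def by blast+
  show "mat_adjoint U * U = 1\<^sub>m n"
    by (rule mat_mult_left_right_inverse[OF U(1) mat_adjoint_carrier[OF U(1)] U(2)])
qed

lemma unitary_matI:
  assumes "U \<in> carrier_mat n n" "mat_adjoint U * U = 1\<^sub>m n"
  shows "unitary_mat n U"
  using mat_mult_left_right_inverse[OF mat_adjoint_carrier[OF assms(1)] assms] assms(1)
  unfolding unitary_mat_def by blast

lemma unitary_mat_adjoint: "unitary_mat n U \<Longrightarrow> unitary_mat n (mat_adjoint U)"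
  by (frule unitary_matD(1), drule unitary_matD(3)) (simp add: unitary_mat_def)

lemma unitary_mat_transpose:
  assumes "unitary_mat n U"
  shows "unitary_mat n (transpose_mat U)"
proof -
  note U = unitary_matD[OF assms]
  have "transpose_mat (mat_adjoint U * U) = transpose_mat U * mat_adjoint (transpose_mat U)"
    using U(1) by (subst transpose_mult[of _ n n _ n]) (auto simp: mat_adjoint_transpose)
  then show ?thesis using U by (simp add: unitary_mat_def)
qed

lemma unitary_mat_mult:
  assumes "unitary_mat n U" "unitary_mat n V"
  shows "unitary_mat n (U * V)"
proof -
  note U = unitary_matD[OF assms(1)] and V = unitary_matD[OF assms(2)]
  have "(U * V) * mat_adjoint (U * V) = U * (V * mat_adjoint V) * mat_adjoint U"
    using U(1) V(1) by (simp add: sq_mat[where n = n])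
  then show ?thesis using U V by (simp add: unitary_mat_def)
qed

section \<open>Unitary diagonalization of Hermitian matrices\<close>

lemma exists_eigenvector:
  fixes A :: "complex mat"
  assumes "A \<in> carrier_mat n n" "0 < n"
  obtains v e where "v \<in> carrier_vec n" "v \<noteq> 0\<^sub>v n" "A *\<^sub>v v = e \<cdot>\<^sub>v v"
proof -
  have "degree (char_poly A) = n" using degree_monic_char_poly[OF assms(1)] by simp
  then have "\<not> constant (poly (char_poly A))"
    using assms(2) by (simp add: constant_degree)
  then obtain e where "poly (char_poly A) e = 0"
    using fundamental_theorem_of_algebra by blast
  then have "eigenvalue A e" using eigenvalue_root_char_poly[OF assms(1)] by simp
  then show thesis using that assms by (auto simp: eigenvalue_def eigenvector_def)
qed

text \<open>Complete \<open>v\<close> to a basis and orthogonalize by Gram-Schmidt, which keeps the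
  first vector. Normalizing the columns is why only a multiple of \<open>v\<close> appears.\<close>

lemma unitary_mat_with_first_column:
  fixes v :: "complex vec"
  assumes v: "v \<in> carrier_vec n" "v \<noteq> 0\<^sub>v n"
  obtains U c where "unitary_mat n U" "col U 0 = c \<cdot>\<^sub>v v"
proof -
  interpret cof_vec_space n "TYPE(complex)" .
  have n: "0 < n" using v by (cases n) auto
  define b where "b = basis_completion v"
  define ws where "ws = gram_schmidt n b"
  from basis_completion[OF v, folded b_def] have b: "distinct b" "\<not> lin_dep (set b)"
    "set b \<subseteq> carrier_vec n" "hd b = v" "length b = n" by auto
  from b n obtain vs where bv: "b = v # vs" by (cases b, auto)
  from gram_schmidt_result[OF b(3,1,2) refl, folded ws_def]
  have ws: "set ws \<subseteq> carrier_vec n" "corthogonal ws" "length ws = n"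
    by (auto simp: b)
  have "hd ws = v" using gram_schmidt_hd[OF v(1), of vs, folded bv] unfolding ws_def .
  then have ws0: "ws ! 0 = v" using ws n by (metis hd_conv_nth length_0_conv less_irrefl)
  \<comment> \<open>Gram-Schmidt yields orthogonal vectors of arbitrary length; \<open>r j\<close>
    is the length of the \<open>j\<close>-th one, as a complex number.\<close>
  define r where "r j = complex_of_real (sqrt (Re (ws ! j \<bullet>c ws ! j)))" for j
  define U where "U = mat n n (\<lambda>(i, j). ws ! j $ i / r j)"
  have wsc: "ws ! j \<in> carrier_vec n" if "j < n" for j using ws that by auto
  have r: "r j * r j = ws ! j \<bullet>c ws ! j" "r j \<noteq> 0" if "j < n" for j
  proof -
    have pos: "ws ! j \<bullet>c ws ! j \<ge> 0" by (rule conjugate_square_ge_0_vec)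
    have "ws ! j \<bullet>c ws ! j \<noteq> 0" using corthogonalD[OF ws(2)] ws that by auto
    then show "r j * r j = ws ! j \<bullet>c ws ! j" "r j \<noteq> 0"
      using pos by (auto simp: r_def less_eq_complex_def complex_eq_iff simp flip: of_real_mult)
  qed
  have rc: "cnj (r j) = r j" for j by (simp add: r_def)
  have U: "U \<in> carrier_mat n n" by (simp add: U_def)
  have "mat_adjoint U * U = 1\<^sub>m n"
  proof (rule eq_matI)
    fix i j assume "i < dim_row (1\<^sub>m n :: complex mat)" "j < dim_col (1\<^sub>m n :: complex mat)"
    then have ij: "i < n" "j < n" by auto
    have "(mat_adjoint U * U) $$ (i, j) = (\<Sum>k<n. cnj (ws ! i $ k / r i) * (ws ! j $ k / r j))"
      using U ij by (simp add: mult_mat_index[of _ n n _ n] mat_adjoint_index[of _ n n] U_def del: index_mult_mat)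
    also have "\<dots> = (\<Sum>k<n. ws ! j $ k * cnj (ws ! i $ k)) / (r i * r j)"
      by (simp add: rc sum_divide_distrib mult.commute)
    also have "(\<Sum>k<n. ws ! j $ k * cnj (ws ! i $ k)) = ws ! j \<bullet>c ws ! i"
      using wsc[OF ij(1)] wsc[OF ij(2)] by (auto simp: scalar_prod_def lessThan_atLeast0)
    also have "\<dots> / (r i * r j) = 1\<^sub>m n $$ (i, j)"
      using ij r corthogonalD[OF ws(2), of j i] ws by auto
    finally show "(mat_adjoint U * U) $$ (i, j) = 1\<^sub>m n $$ (i, j)" .
  qed (use U in \<open>auto simp: mat_adjoint_def\<close>)
  then have "unitary_mat n U" using U by (intro unitary_matI)
  moreover have "col U 0 = (1 / r 0) \<cdot>\<^sub>v v"
    using v n by (intro eq_vecI) (auto simp: U_def ws0)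
  ultimately show thesis by (rule that)
qed

text \<open>Deflation: with an eigenvector as first column of a unitary matrix, conjugation splits
  off a 1 by 1 block, and the remaining block is again Hermitian.\<close>

theorem hermitian_unitary_diagonalization:
  fixes A :: "complex mat"
  assumes "A \<in> carrier_mat n n" "mat_adjoint A = A"
  shows "\<exists>P. unitary_mat n P \<and> diagonal_mat (mat_adjoint P * A * P)"
  using assms
proof (induction n arbitrary: A)
  case 0
  have "unitary_mat 0 (1\<^sub>m 0)" by (auto simp: unitary_mat_def mat_adjoint_def)
  then show ?case using 0 by (intro exI[of _ "1\<^sub>m 0"]) (auto simp: diagonal_mat_def mat_adjoint_def)
next
  case (Suc n)
  let ?N = "Suc n"
  note A = Suc.prems
  obtain v e where v: "v \<in> carrier_vec ?N" "v \<noteq> 0\<^sub>v ?N" "A *\<^sub>v v = e \<cdot>\<^sub>v v"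
    using exists_eigenvector[OF A(1)] by auto
  obtain U c where U: "unitary_mat ?N U" "col U 0 = c \<cdot>\<^sub>v v"
    using unitary_mat_with_first_column[OF v(1,2)] .
  note Uc = unitary_matD[OF U(1)]
  define B where "B = mat_adjoint U * A * U"
  have B: "B \<in> carrier_mat ?N ?N" using A Uc by (simp add: B_def sq_mat[where n = ?N])
  have Bh: "mat_adjoint B = B"
    using A Uc(1) by (simp add: B_def sq_mat[where n = ?N])
  have Bsym: "B $$ (i, j) = cnj (B $$ (j, i))" if "i < ?N" "j < ?N" for i j
    using mat_adjoint_index[OF B that] Bh by simp
  have cU: "col U 0 \<in> carrier_vec ?N" using Uc(1) by (metis carrier_matD(1) carrier_vec_dim_vec dim_col)
  have "col B 0 = mat_adjoint U *\<^sub>v (A *\<^sub>v col U 0)"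
  proof -
    have AU: "A * U \<in> carrier_mat ?N ?N" using A(1) Uc(1) by (rule mult_carrier_mat)
    have "B = mat_adjoint U * (A * U)" using A(1) Uc(1) by (simp add: B_def sq_mat[where n = ?N])
    then show ?thesis
      by (simp only: col_mult2[OF mat_adjoint_carrier[OF Uc(1)] AU zero_less_Suc] col_mult2[OF A(1) Uc(1) zero_less_Suc])
  qed
  also have "A *\<^sub>v col U 0 = e \<cdot>\<^sub>v col U 0"
    using A v U(2) by (simp add: mult_mat_vec[of _ ?N ?N] smult_smult_assoc mult.commute)
  also have "mat_adjoint U *\<^sub>v (e \<cdot>\<^sub>v col U 0) = e \<cdot>\<^sub>v col (mat_adjoint U * U) 0"
    using Uc(1) v cU by (subst mult_mat_vec[of _ ?N ?N]) (auto simp: col_mult2[of _ ?N ?N _ ?N])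
  finally have B0: "B $$ (i, 0) = (if i = 0 then e else 0)" if "i < ?N" for i
    using that B Uc(3) by (auto simp: vec_eq_iff)
  \<comment> \<open>Hermitian symmetry carries the zeros of the first column over to the first
    row.\<close>
  have B0': "B $$ (0, i) = (if i = 0 then B $$ (0, 0) else 0)" if "i < ?N" for i
    using that B0 Bsym[of 0 i] by auto
  define C where "C = mat n n (\<lambda>(i, j). B $$ (Suc i, Suc j))"
  have C: "C \<in> carrier_mat n n" by (simp add: C_def)
  have "mat_adjoint C = C"
  proof (rule eq_matI)
    fix i j assume "i < dim_row C" "j < dim_col C"
    then show "mat_adjoint C $$ (i, j) = C $$ (i, j)"
      using Bsym[of "Suc i" "Suc j"] C by (simp add: mat_adjoint_index[OF C]) (simp add: C_def)
  qed (use C in \<open>auto simp: mat_adjoint_def\<close>)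
  with Suc.IH[OF C] obtain P where P: "unitary_mat n P" "diagonal_mat (mat_adjoint P * C * P)"
    by blast
  note Pc = unitary_matD[OF P(1)]
  let ?e = "mat 1 1 (\<lambda>_. e)"
  have Bblock: "B = four_block_mat ?e (0\<^sub>m 1 n) (0\<^sub>m n 1) C"
    by (rule eq_matI) (use B B0 B0' in \<open>auto simp: C_def\<close>)
  define Q where "Q = four_block_mat (1\<^sub>m 1) (0\<^sub>m 1 n) (0\<^sub>m n 1) P"
  have Q: "Q \<in> carrier_mat ?N ?N" using Pc(1) by (auto simp: Q_def)
  have Qa: "mat_adjoint Q = four_block_mat (1\<^sub>m 1) (0\<^sub>m 1 n) (0\<^sub>m n 1) (mat_adjoint P)"
    by (rule eq_matI) (use Pc(1) in \<open>auto simp: mat_adjoint_index_dim Q_def\<close>)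
  have "mat_adjoint Q * Q = four_block_mat (1\<^sub>m 1) (0\<^sub>m 1 n) (0\<^sub>m n 1) (mat_adjoint P * P)"
    unfolding Qa unfolding Q_def using Pc(1) 
    by (subst mult_four_block_mat[of _ 1 1 _ n _ n _ _ 1 _ n]) auto
  then have "unitary_mat ?N Q" using Q Pc(3) by (intro unitary_matI) auto
  then have "unitary_mat ?N (U * Q)" using U(1) by (intro unitary_mat_mult)
  moreover have "mat_adjoint (U * Q) * A * (U * Q) = mat_adjoint Q * B * Q"
    using Uc(1) Q A(1) by (simp add: B_def sq_mat[where n = ?N])
  moreover have "mat_adjoint Q * B * Q
      = four_block_mat ?e (0\<^sub>m 1 n) (0\<^sub>m n 1) (mat_adjoint P * C * P)"
  proof -
    have 1: "mat_adjoint Q * B = four_block_mat ?e (0\<^sub>m 1 n) (0\<^sub>m n 1) (mat_adjoint P * C)"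
      unfolding Qa Bblock using Pc(1) C
      by (subst mult_four_block_mat[of _ 1 1 _ n _ n _ _ 1 _ n]) auto
    show ?thesis unfolding 1 unfolding Q_def using Pc(1) C 
      by (subst mult_four_block_mat[of _ 1 1 _ n _ n _ _ 1 _ n]) auto
  qed
  moreover have "diagonal_mat \<dots>"
  proof -
    define D where "D = mat_adjoint P * C * P"
    have D: "D \<in> carrier_mat n n" using Pc(1) C by (simp add: D_def sq_mat[where n = n])
    have D0: "i = j" if "i < n" "j < n" "D $$ (i, j) \<noteq> 0" for i j
      using P(2)[folded D_def, unfolded diagonal_mat_def, rule_format, of i j] D that by auto
    show ?thesis
      unfolding D_def[symmetric] using D by (auto simp: diagonal_mat_def less_Suc_eq_0_disj dest: D0)
  qed
  ultimately show ?case by (intro exI[of _ "U * Q"]) simp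
qed

section \<open>Traces and the Frobenius norm\<close>

lemma mat_trace_eq: "A \<in> carrier_mat n m \<Longrightarrow> mat_trace A = (\<Sum>i<n. A $$ (i, i))"
  by (auto simp: mat_trace_def)

lemma mat_trace_add:
  assumes "A \<in> carrier_mat n n" "B \<in> carrier_mat n n"
  shows "mat_trace (A + B) = mat_trace A + mat_trace B"
  using assms by (simp add: mat_trace_def sum.distrib)

lemma mat_trace_minus:
  assumes "A \<in> carrier_mat n n" "B \<in> carrier_mat n n"
  shows "mat_trace (A - B) = mat_trace A - mat_trace B"
  using assms by (simp add: mat_trace_def sum_subtractf)

lemma mat_trace_transpose:
  assumes "A \<in> carrier_mat n n"
  shows "mat_trace (transpose_mat A) = mat_trace A"
  using assms by (simp add: mat_trace_def)

lemma mat_trace_mult_eq: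
  assumes "A \<in> carrier_mat n m" "B \<in> carrier_mat m n"
  shows "mat_trace (A * B) = (\<Sum>i<n. \<Sum>k<m. A $$ (i, k) * B $$ (k, i))"
  using assms by (simp add: mat_trace_eq[of _ n n] mult_mat_index[of _ n m _ n] del: index_mult_mat)

lemma mat_trace_mult_comm:
  assumes "A \<in> carrier_mat n m" "B \<in> carrier_mat m n"
  shows "mat_trace (A * B) = mat_trace (B * A)"
  unfolding mat_trace_mult_eq[OF assms] mat_trace_mult_eq[OF assms(2,1)]
  by (subst sum.swap) (simp add: mult.commute)

lemma mat_trace_adjoint_mult_eq:
  fixes A B :: "complex mat"
  assumes "A \<in> carrier_mat n m" "B \<in> carrier_mat n m"
  shows "mat_trace (mat_adjoint A * B) = (\<Sum>i<n. \<Sum>j<m. cnj (A $$ (i, j)) * B $$ (i, j))"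
  using assms
  by (subst mat_trace_mult_eq[of _ m n], simp, simp, subst sum.swap) (simp add: mat_adjoint_index[of _ n m])

lemma mat_trace_adjoint_mult_self:
  assumes "A \<in> carrier_mat n m"
  shows "mat_trace (mat_adjoint A * A) = complex_of_real (\<Sum>i<n. \<Sum>j<m. (cmod (A $$ (i, j)))\<^sup>2)"
  unfolding mat_trace_adjoint_mult_eq[OF assms assms]
  by (simp add: complex_norm_square mult.commute del: of_real_power)

lemma frob_norm_square:
  assumes "A \<in> carrier_mat n m"
  shows "(frob_norm A)\<^sup>2 = (\<Sum>i<n. \<Sum>j<m. (cmod (A $$ (i, j)))\<^sup>2)"
  unfolding frob_norm_def mat_trace_adjoint_mult_self[OF assms]
  by (simp add: sum_nonneg)

lemma frob_norm_square_trace: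
  assumes "A \<in> carrier_mat n m"
  shows "mat_trace (mat_adjoint A * A) = complex_of_real ((frob_norm A)\<^sup>2)"
  unfolding frob_norm_square[OF assms] mat_trace_adjoint_mult_self[OF assms] ..

text \<open>Matrices are read as vectors indexed by positions, and the real inequality for
  \<open>L2_set\<close> is applied to the absolute values.\<close>

lemma cauchy_schwarz_mat_trace:
  fixes A B :: "complex mat"
  assumes "A \<in> carrier_mat n m" "B \<in> carrier_mat n m"
  shows "(cmod (mat_trace (mat_adjoint A * B)))\<^sup>2 \<le> (frob_norm A)\<^sup>2 * (frob_norm B)\<^sup>2"
proof -
  let ?I = "{..<n} \<times> {..<m}"
  have "mat_trace (mat_adjoint A * B) = (\<Sum>p\<in>?I. cnj (A $$ p) * B $$ p)"
    unfolding mat_trace_adjoint_mult_eq[OF assms] by (simp add: sum.cartesian_product split_def)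
  then have "cmod (mat_trace (mat_adjoint A * B)) \<le> (\<Sum>p\<in>?I. cmod (A $$ p) * cmod (B $$ p))"
    by (auto intro!: sum_norm_le simp: norm_mult)
  then have "(cmod (mat_trace (mat_adjoint A * B)))\<^sup>2 \<le> (\<Sum>p\<in>?I. cmod (A $$ p) * cmod (B $$ p))\<^sup>2"
    by (intro power_mono) auto
  also have "\<dots> \<le> (\<Sum>p\<in>?I. (cmod (A $$ p))\<^sup>2) * (\<Sum>p\<in>?I. (cmod (B $$ p))\<^sup>2)"
    using power_mono[OF L2_set_mult_ineq[of "\<lambda>p. cmod (A $$ p)" "\<lambda>p. cmod (B $$ p)" ?I], of 2]
    by (simp add: L2_set_def power_mult_distrib sum_nonneg)
  also have "\<dots> = (frob_norm A)\<^sup>2 * (frob_norm B)\<^sup>2"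
    unfolding frob_norm_square[OF assms(1)] frob_norm_square[OF assms(2)]
    by (simp add: sum.cartesian_product split_def)
  finally show ?thesis .
qed

section \<open>The variance bound\<close>

text \<open>Expand the right side into a double sum. Keep the diagonal terms exactly and bound the
  cross terms by |y i + y j|^2 >= 0. Comparing coefficients of |y i|^2 then leaves (t - 2 p i)^2 >=
  0, with t the total weight.\<close>

lemma weighted_mean_square_lower:
  fixes p :: "'a \<Rightarrow> real" and y :: "'a \<Rightarrow> complex"
  assumes "finite I" "\<And>i. i \<in> I \<Longrightarrow> 0 \<le> p i"
  shows "(\<Sum>i\<in>I. (2 * sum p I * p i - (sum p I)\<^sup>2) * (cmod (y i))\<^sup>2)
    \<le> 2 * (cmod (\<Sum>i\<in>I. of_real (p i) * y i))\<^sup>2"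
proof -
  define t where "t = sum p I"
  let ?q = "\<lambda>i. (cmod (y i))\<^sup>2"
  \<comment> \<open>The factor 4 makes the diagonal case of \<open>pt\<close> an equality:
    subtracting \<open>p i * p i * (?q i + ?q i)\<close> leaves exactly the diagonal term of
    \<open>m\<close>.\<close>
  let ?d = "\<lambda>i j. if i = j then 4 * (p i)\<^sup>2 * ?q i else 0"
  have "complex_of_real ((cmod (\<Sum>i\<in>I. of_real (p i) * y i))\<^sup>2)
      = (\<Sum>i\<in>I. \<Sum>j\<in>I. of_real (p i * p j) * (y i * cnj (y j)))"
    unfolding complex_norm_square by (simp add: sum_product mult_ac)
  then have "(cmod (\<Sum>i\<in>I. of_real (p i) * y i))\<^sup>2
      = Re (\<Sum>i\<in>I. \<Sum>j\<in>I. of_real (p i * p j) * (y i * cnj (y j)))"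
    by (metis Re_complex_of_real)
  also have "\<dots> = (\<Sum>i\<in>I. \<Sum>j\<in>I. p i * p j * Re (y i * cnj (y j)))"
    by (simp add: Re_sum)
  finally have m: "2 * (cmod (\<Sum>i\<in>I. of_real (p i) * y i))\<^sup>2
      = (\<Sum>i\<in>I. \<Sum>j\<in>I. p i * p j * (2 * Re (y i * cnj (y j))))"
    by (simp add: sum_distrib_left mult_ac)
  have pt: "?d i j - p i * p j * (?q i + ?q j) \<le> p i * p j * (2 * Re (y i * cnj (y j)))"
    if "i \<in> I" "j \<in> I" for i j
  proof (cases "i = j")
    case True
    then show ?thesis
      by (simp add: cmod_power2 power2_eq_square[of "p _"]) (simp add: power2_eq_square algebra_simps)
  next
    case False
    have "0 \<le> (Re (y i) + Re (y j))\<^sup>2 + (Im (y i) + Im (y j))\<^sup>2" by simp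
    also have "\<dots> = 2 * Re (y i * cnj (y j)) + (?q i + ?q j)"
      unfolding cmod_power2 by (simp add: power2_eq_square algebra_simps)
    finally have "0 \<le> p i * p j * (2 * Re (y i * cnj (y j)) + (?q i + ?q j))"
      using assms(2) that by (intro mult_nonneg_nonneg) auto
    then show ?thesis using False by (simp add: algebra_simps)
  qed
  have "(\<Sum>i\<in>I. (2 * t * p i - t\<^sup>2) * ?q i) \<le> (\<Sum>i\<in>I. (4 * (p i)\<^sup>2 - 2 * t * p i) * ?q i)"
  proof (intro sum_mono mult_right_mono)
    fix i
    have "0 \<le> (t - 2 * p i)\<^sup>2" by simp
    then show "2 * t * p i - t\<^sup>2 \<le> 4 * (p i)\<^sup>2 - 2 * t * p i"
      by (simp add: power2_eq_square algebra_simps)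
  qed simp
  also have "\<dots> = (\<Sum>i\<in>I. \<Sum>j\<in>I. ?d i j - p i * p j * (?q i + ?q j))"
  proof -
    have 1: "(\<Sum>i\<in>I. \<Sum>j\<in>I. p i * p j * ?q j) = (\<Sum>i\<in>I. t * p i * ?q i)"
      by (subst sum.swap) (simp add: t_def sum_distrib_left sum_distrib_right mult_ac)
    have 2: "(\<Sum>i\<in>I. \<Sum>j\<in>I. p i * p j * ?q i) = (\<Sum>i\<in>I. t * p i * ?q i)"
      by (simp add: t_def sum_distrib_left sum_distrib_right mult_ac)
    have 3: "(\<Sum>i\<in>I. \<Sum>j\<in>I. ?d i j) = (\<Sum>i\<in>I. 4 * (p i)\<^sup>2 * ?q i)"
      using assms(1) by (simp add: sum.delta)
    show ?thesis
      by (simp only: distrib_left sum_subtractf sum.distrib 1 2 3 left_diff_distrib)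
         (simp add: sum_distrib_left sum_subtractf sum_negf mult_ac flip: sum.distrib)
  qed
  also have "\<dots> \<le> (\<Sum>i\<in>I. \<Sum>j\<in>I. p i * p j * (2 * Re (y i * cnj (y j))))"
    by (intro sum_mono pt)
  finally show ?thesis unfolding m t_def .
qed

text \<open>Two distinct weights add up to at most the total \<open>t\<close>, which settles the
  off-diagonal entries. On the diagonal \<open>2 * p i\<close> may exceed \<open>t\<close>; the
  weighted mean absorbs this excess by the previous lemma.\<close>

lemma weighted_variance_bound:
  fixes p :: "'a \<Rightarrow> real" and x :: "'a \<Rightarrow> 'a \<Rightarrow> complex"
  assumes "finite I" "\<And>i. i \<in> I \<Longrightarrow> 0 \<le> p i"
  shows "sum p I * (\<Sum>i\<in>I. \<Sum>j\<in>I. (p i + p j) * (cmod (x i j))\<^sup>2)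
    \<le> (sum p I)\<^sup>2 * (\<Sum>i\<in>I. \<Sum>j\<in>I. (cmod (x i j))\<^sup>2) + 2 * (cmod (\<Sum>i\<in>I. of_real (p i) * x i i))\<^sup>2"
proof -
  define t where "t = sum p I"
  let ?d = "\<lambda>i j. if i = j then (2 * t * p i - t\<^sup>2) * (cmod (x i i))\<^sup>2 else 0"
  have t: "0 \<le> t" using assms by (auto simp: t_def intro: sum_nonneg)
  have pt: "t * (p i + p j) * (cmod (x i j))\<^sup>2 \<le> t\<^sup>2 * (cmod (x i j))\<^sup>2 + ?d i j"
    if "i \<in> I" "j \<in> I" for i j
  proof (cases "i = j")
    case True
    then show ?thesis by (simp add: algebra_simps)
  next
    case False
    have "p i + p j = sum p {i, j}" using False by simp
    also have "\<dots> \<le> t" unfolding t_def using assms that by (intro sum_mono2) auto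
    finally have "t * (p i + p j) \<le> t\<^sup>2" using t by (simp add: power2_eq_square mult_left_mono)
    then show ?thesis using False by (simp add: mult_right_mono)
  qed
  have "t * (\<Sum>i\<in>I. \<Sum>j\<in>I. (p i + p j) * (cmod (x i j))\<^sup>2)
      = (\<Sum>i\<in>I. \<Sum>j\<in>I. t * (p i + p j) * (cmod (x i j))\<^sup>2)"
    by (simp add: sum_distrib_left mult.assoc)
  also have "\<dots> \<le> (\<Sum>i\<in>I. \<Sum>j\<in>I. t\<^sup>2 * (cmod (x i j))\<^sup>2 + ?d i j)"
    by (intro sum_mono pt)
  also have "\<dots> = t\<^sup>2 * (\<Sum>i\<in>I. \<Sum>j\<in>I. (cmod (x i j))\<^sup>2) + (\<Sum>i\<in>I. (2 * t * p i - t\<^sup>2) * (cmod (x i i))\<^sup>2)"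
    using assms(1) by (simp add: sum.distrib sum_distrib_left sum.delta)
  also have "(\<Sum>i\<in>I. (2 * t * p i - t\<^sup>2) * (cmod (x i i))\<^sup>2) \<le> 2 * (cmod (\<Sum>i\<in>I. of_real (p i) * x i i))\<^sup>2"
    unfolding t_def using assms by (rule weighted_mean_square_lower)
  finally show ?thesis unfolding t_def by simp
qed

text \<open>Conjugation into an eigenbasis of \<open>D\<close> preserves products, adjoints, traces
  and Frobenius norms, so the weighted bound applies with the eigenvalues of \<open>D\<close> as
  weights. They are nonnegative because \<open>D\<close> is a sum of two Gram products.\<close>

lemma matrix_variance_bound:
  fixes X K L :: "complex mat"
  assumes X: "X \<in> carrier_mat n n" and K: "K \<in> carrier_mat n n" and L: "L \<in> carrier_mat n n"
  defines "D \<equiv> K * mat_adjoint K + L * mat_adjoint L"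
  shows "Re (mat_trace D) * Re (mat_trace (mat_adjoint X * X * D) + mat_trace (X * mat_adjoint X * D))
    \<le> (Re (mat_trace D))\<^sup>2 * (frob_norm X)\<^sup>2 + 2 * (cmod (mat_trace (mat_adjoint X * D)))\<^sup>2"
proof -
  note sq = sq_mat[where n = n]
  have D: "D \<in> carrier_mat n n" using K L by (simp add: D_def sq)
  have Dh: "mat_adjoint D = D"
    using K L by (simp add: D_def sq mat_adjoint_add[of _ n n])
  obtain P where P: "unitary_mat n P" and diag: "diagonal_mat (mat_adjoint P * D * P)"
    using hermitian_unitary_diagonalization[OF D Dh] by blast
  note Pc = unitary_matD[OF P]
  define c where "c Z = mat_adjoint P * Z * P" for Z
  have c: "c Z \<in> carrier_mat n n" if "Z \<in> carrier_mat n n" for Z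
    using that Pc(1) by (simp add: c_def sq)
  have c_mult: "c (Z * V) = c Z * c V" if "Z \<in> carrier_mat n n" "V \<in> carrier_mat n n" for Z V
  proof -
    have "c Z * c V = mat_adjoint P * Z * (P * mat_adjoint P) * V * P"
      using that Pc(1) by (simp add: c_def sq)
    then show ?thesis using that Pc by (simp add: c_def sq)
  qed
  have c_adj: "c (mat_adjoint Z) = mat_adjoint (c Z)" if "Z \<in> carrier_mat n n" for Z
    using that Pc(1) by (simp add: c_def sq)
  have c_add: "c (Z + V) = c Z + c V" if "Z \<in> carrier_mat n n" "V \<in> carrier_mat n n" for Z V
    using that Pc(1)
    by (simp add: c_def sq mult_add_distrib_mat[of _ n n _ n] add_mult_distrib_mat[of _ n n _ _ n])
  have c_trace: "mat_trace (c Z) = mat_trace Z" if "Z \<in> carrier_mat n n" for Z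
  proof -
    have "mat_trace (c Z) = mat_trace (P * (mat_adjoint P * Z))"
      unfolding c_def using that Pc(1) by (intro mat_trace_mult_comm[of _ n n]) (simp_all add: sq)
    also have "P * (mat_adjoint P * Z) = (P * mat_adjoint P) * Z"
      using that Pc(1) by (simp add: sq)
    finally show ?thesis using that Pc(2) by simp
  qed
  define p where "p i = Re (c D $$ (i, i))" for i
  define Y where "Y = c X"
  note Y = c[OF X, folded Y_def]
  have cD: "c D $$ (i, j) = (if i = j then of_real (p i) else 0)" if "i < n" "j < n" for i j
  proof -
    have "c D $$ (i, i) = cnj (c D $$ (i, i))"
      using mat_adjoint_index[OF c[OF D], of i i] c_adj[OF D] that by (simp add: Dh)
    then have "c D $$ (i, i) = of_real (p i)" by (simp add: p_def complex_eq_iff)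
    moreover have "c D $$ (i, j) = 0" if "i \<noteq> j"
      using diag[folded c_def, unfolded diagonal_mat_def, rule_format, of i j] c[OF D]
        \<open>i < n\<close> \<open>j < n\<close> that by simp
    ultimately show ?thesis by auto
  qed
  have gram: "0 \<le> Re ((Z * mat_adjoint Z) $$ (i, i))" if "Z \<in> carrier_mat n n" "i < n" for Z i
    using that
    by (simp add: mult_mat_index[of _ n n _ n] mat_adjoint_index[of _ n n] Re_sum sum_nonneg del: index_mult_mat)
  have p: "0 \<le> p i" if "i < n" for i
  proof -
    have "c D = c K * mat_adjoint (c K) + c L * mat_adjoint (c L)"
      using K L by (simp add: D_def c_add c_mult c_adj sq)
    moreover have "c K \<in> carrier_mat n n" "c L \<in> carrier_mat n n" using c K L by auto
    ultimately show ?thesis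
      using gram[of "c K" i] gram[of "c L" i] that by (simp add: p_def)
  qed
  have "mat_trace D = mat_trace (c D)" using c_trace D by simp
  also have "\<dots> = of_real (sum p {..<n})"
    using cD by (simp add: mat_trace_eq[OF c[OF D]])
  finally have tD: "Re (mat_trace D) = sum p {..<n}" by simp
  have trD: "mat_trace (Z * D) = (\<Sum>i<n. of_real (p i) * c Z $$ (i, i))"
    if "Z \<in> carrier_mat n n" for Z
  proof -
    have "mat_trace (Z * D) = mat_trace (c Z * c D)"
      using that D c_trace[of "Z * D"] by (simp add: c_mult sq)
    also have "\<dots> = (\<Sum>i<n. \<Sum>k<n. c Z $$ (i, k) * c D $$ (k, i))"
      using that D c by (intro mat_trace_mult_eq) auto
    also have "\<dots> = (\<Sum>i<n. of_real (p i) * c Z $$ (i, i))"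
      by (intro sum.cong refl) (simp add: cD if_distrib sum.delta mult.commute cong: if_cong)
    finally show ?thesis .
  qed
  \<comment> \<open>The two orders of \<open>X\<close> and its adjoint put the weight on the column
    index and on the row index of \<open>Y\<close>; together they give the factor p i + p j.\<close>
  have "mat_trace (mat_adjoint X * X * D) = (\<Sum>i<n. of_real (p i) * (mat_adjoint Y * Y) $$ (i, i))"
    using X by (subst trD) (simp_all add: sq c_mult c_adj Y_def)
  also have "\<dots> = of_real (\<Sum>i<n. \<Sum>j<n. p i * (cmod (Y $$ (j, i)))\<^sup>2)"
    using Y by (simp add: mult_mat_index[of _ n n _ n] mat_adjoint_index[of _ n n] sum_distrib_left
        complex_norm_square mult_ac del: index_mult_mat of_real_power)
  also have "(\<Sum>i<n. \<Sum>j<n. p i * (cmod (Y $$ (j, i)))\<^sup>2) = (\<Sum>i<n. \<Sum>j<n. p j * (cmod (Y $$ (i, j)))\<^sup>2)"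
    by (rule sum.swap)
  finally have 1: "Re (mat_trace (mat_adjoint X * X * D)) = \<dots>" by simp
  have "mat_trace (X * mat_adjoint X * D) = (\<Sum>i<n. of_real (p i) * (Y * mat_adjoint Y) $$ (i, i))"
    using X by (subst trD) (simp_all add: sq c_mult c_adj Y_def)
  also have "\<dots> = of_real (\<Sum>i<n. \<Sum>j<n. p i * (cmod (Y $$ (i, j)))\<^sup>2)"
    using Y by (simp add: mult_mat_index[of _ n n _ n] mat_adjoint_index[of _ n n] sum_distrib_left
        complex_norm_square mult_ac del: index_mult_mat of_real_power)
  finally have 2: "Re (mat_trace (X * mat_adjoint X * D)) = (\<Sum>i<n. \<Sum>j<n. p i * (cmod (Y $$ (i, j)))\<^sup>2)"
    by simp
  have "mat_trace (mat_adjoint X * D) = (\<Sum>i<n. of_real (p i) * cnj (Y $$ (i, i)))"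
    using X Y by (simp add: trD c_adj mat_adjoint_index[of _ n n] flip: Y_def)
  also have "\<dots> = cnj (\<Sum>i<n. of_real (p i) * Y $$ (i, i))" by simp
  finally have 3: "cmod (mat_trace (mat_adjoint X * D)) = cmod (\<Sum>i<n. of_real (p i) * Y $$ (i, i))"
    by (simp only: complex_mod_cnj)
  have "complex_of_real ((frob_norm X)\<^sup>2) = mat_trace (c (mat_adjoint X * X))"
    using X by (simp add: c_trace sq frob_norm_square_trace)
  also have "\<dots> = of_real ((frob_norm Y)\<^sup>2)"
    using X Y by (simp add: c_mult c_adj frob_norm_square_trace[of _ n n] flip: Y_def)
  finally have 4: "(frob_norm X)\<^sup>2 = (\<Sum>i<n. \<Sum>j<n. (cmod (Y $$ (i, j)))\<^sup>2)"
    using frob_norm_square[OF Y] by (simp only: of_real_eq_iff)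
  show ?thesis
    unfolding tD 3 4 plus_complex.sel 1 2
    using weighted_variance_bound[of "{..<n}" p "\<lambda>i j. Y $$ (i, j)"] p
    by (simp add: distrib_right sum.distrib add.commute)
qed

section \<open>Frobenius norms of generalized commutators\<close>

lemma frob_norm_eq_0:
  assumes "A \<in> carrier_mat n m" "frob_norm A = 0"
  shows "A = 0\<^sub>m n m"
proof (rule eq_matI)
  fix i j assume "i < dim_row (0\<^sub>m n m :: complex mat)" "j < dim_col (0\<^sub>m n m :: complex mat)"
  moreover have "(\<Sum>i<n. \<Sum>j<m. (cmod (A $$ (i, j)))\<^sup>2) = 0"
    using frob_norm_square[OF assms(1)] assms(2) by simp
  ultimately show "A $$ (i, j) = 0\<^sub>m n m $$ (i, j)"
    by (simp add: sum_nonneg_eq_0_iff sum_nonneg)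
qed (use assms in auto)

text \<open>
  The trace hypotheses say that, as far as first and second moments are concerned, \<open>L * mat_adjoint L\<close>
  plays for \<open>A\<close> the role that \<open>mat_adjoint N * N\<close> plays for \<open>F\<close>.
\<close>

lemma intertwiner_norm_bound:
  fixes A F N L :: "complex mat"
  assumes A: "A \<in> carrier_mat n n" and F: "F \<in> carrier_mat n n"
    and N: "N \<in> carrier_mat n n" and L: "L \<in> carrier_mat n n"
    and tr0: "mat_trace (L * mat_adjoint L) = mat_trace (N * mat_adjoint N)"
    and tr1: "mat_trace (mat_adjoint F * (mat_adjoint N * N)) = mat_trace (mat_adjoint A * (L * mat_adjoint L))"
    and tr2: "mat_trace (mat_adjoint F * F * (mat_adjoint N * N)) + mat_trace (F * mat_adjoint F * (mat_adjoint N * N))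
      = mat_trace (mat_adjoint A * A * (L * mat_adjoint L)) + mat_trace (A * mat_adjoint A * (L * mat_adjoint L))"
  shows "(frob_norm (A * N - N * F))\<^sup>2 \<le> 2 * (frob_norm A)\<^sup>2 * (frob_norm N)\<^sup>2"
\<comment> \<open>The argument ends with a division by the squared norm of \<open>N\<close>.\<close>
proof (cases "frob_norm N = 0")
  case True
  then have "N = 0\<^sub>m n n" using frob_norm_eq_0[OF N] by simp
  then have "A * N - N * F = 0\<^sub>m n n" using A F by simp
  moreover have "(frob_norm (0\<^sub>m n n))\<^sup>2 = 0" by (subst frob_norm_square[of _ n n]) auto
  ultimately show ?thesis using True by simp
next
  case False
  note sq = sq_mat[where n = n]
  note minus_carrier = minus_carrier_mat[of _ n n]
  define M1 M2 where "M1 = A * N - N * F" and "M2 = mat_adjoint A * N + N * mat_adjoint F"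
  have M1: "M1 \<in> carrier_mat n n" and M2: "M2 \<in> carrier_mat n n"
    using A F N by (simp_all add: M1_def M2_def sq minus_carrier)
  let ?a = "mat_adjoint A" and ?f = "mat_adjoint F" and ?S = "mat_adjoint N"
  \<comment> \<open>The first summand collects the terms of \<open>A\<close>, the second those of
    \<open>F\<close> after the trace hypotheses have moved them to \<open>A\<close>. Both have the
    squared norm of \<open>N\<close> as trace.\<close>
  define D where "D = N * ?S + L * mat_adjoint L"
  have D: "D \<in> carrier_mat n n" using N L by (simp add: D_def sq)
  have trD: "mat_trace (Z * D) = mat_trace (Z * (N * ?S)) + mat_trace (Z * (L * mat_adjoint L))"
    if "Z \<in> carrier_mat n n" for Z
    using that N L by (simp add: D_def mult_add_distrib_mat[of _ n n _ n] sq mat_trace_add[of _ n])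
  define s where "s = (frob_norm N)\<^sup>2"
  have s: "0 < s" using False by (simp add: s_def)
  have "mat_trace (N * ?S) = of_real s"
    using N mat_trace_mult_comm[of N n n ?S] frob_norm_square_trace[OF N] by (simp add: s_def)
  then have tD: "Re (mat_trace D) = 2 * s"
    using N L tr0 by (simp add: D_def mat_trace_add[of _ n] sq)
  note expand = sq minus_carrier mat_trace_add[of _ n] mat_trace_minus[of _ n]
    mult_add_distrib_mat[of _ n n _ n] add_mult_distrib_mat[of _ n n _ _ n]
    mult_minus_distrib_mat[of _ n n _ n] minus_mult_distrib_mat[of _ n n _ _ n]
  have m1: "complex_of_real ((frob_norm M1)\<^sup>2) = mat_trace (?S * (?a * (A * N))) - mat_trace (?S * (?a * (N * F)))
      - mat_trace (?f * (?S * (A * N))) + mat_trace (?f * (?S * (N * F)))"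
    using A F N unfolding frob_norm_square_trace[OF M1, symmetric]
    by (simp add: M1_def mat_adjoint_minus[of _ n n] expand)
  have m2: "complex_of_real ((frob_norm M2)\<^sup>2) = mat_trace (?S * (A * (?a * N))) + mat_trace (?S * (A * (N * ?f)))
      + mat_trace (F * (?S * (?a * N))) + mat_trace (F * (?S * (N * ?f)))"
    using A F N unfolding frob_norm_square_trace[OF M2, symmetric]
    by (simp add: M2_def mat_adjoint_add[of _ n n] expand)
  have cyc: "mat_trace (Z * V) = mat_trace (V * Z)"
    if "Z \<in> carrier_mat n n" "V \<in> carrier_mat n n" for Z V :: "complex mat"
    using that by (rule mat_trace_mult_comm)
  \<comment> \<open>The mixed terms of the two squared norms cancel by cyclicity of the trace.\<close>
  have "mat_trace (F * (?S * (?a * N))) = mat_trace (?S * (?a * (N * F)))"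
    using A F N cyc[of F "?S * (?a * N)"] by (simp add: sq)
  moreover have "mat_trace (?S * (A * (N * ?f))) = mat_trace (?f * (?S * (A * N)))"
    using A F N cyc[of ?f "?S * (A * N)"] by (simp add: sq)
  moreover have "mat_trace (?S * (?a * (A * N))) = mat_trace (?a * A * (N * ?S))"
    using A F N cyc[of ?S "?a * (A * N)"] by (simp add: sq)
  moreover have "mat_trace (?S * (A * (?a * N))) = mat_trace (A * ?a * (N * ?S))"
    using A F N cyc[of ?S "A * (?a * N)"] by (simp add: sq)
  moreover have "mat_trace (?f * (?S * (N * F))) = mat_trace (F * ?f * (?S * N))"
    using A F N cyc[of F "?f * (?S * N)"] by (simp add: sq)
  moreover have "mat_trace (F * (?S * (N * ?f))) = mat_trace (?f * F * (?S * N))"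
    using A F N cyc[of ?f "F * (?S * N)"] by (simp add: sq)
  ultimately have "complex_of_real ((frob_norm M1)\<^sup>2) + complex_of_real ((frob_norm M2)\<^sup>2)
      = mat_trace (?a * A * D) + mat_trace (A * ?a * D)"
    unfolding m1 m2 using tr2 A by (simp add: trD sq add.commute)
  then have sum: "(frob_norm M1)\<^sup>2 + (frob_norm M2)\<^sup>2 = Re (mat_trace (?a * A * D) + mat_trace (A * ?a * D))"
    by (metis Re_complex_of_real of_real_add)
  \<comment> \<open>By \<open>tr1\<close> the pairing of \<open>N\<close> with \<open>M2\<close> is
    the first moment occurring in the variance bound.\<close>
  have "mat_trace (?S * M2) = mat_trace (?a * D)"
  proof -
    have "mat_trace (?S * M2) = mat_trace (?S * (?a * N)) + mat_trace (?S * (N * ?f))"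
      using A F N by (simp add: M2_def expand)
    also have "mat_trace (?S * (?a * N)) = mat_trace (?a * (N * ?S))"
      using A N cyc[of ?S "?a * N"] by (simp add: sq)
    also have "mat_trace (?S * (N * ?f)) = mat_trace (?f * (?S * N))"
      using F N cyc[of ?f "?S * N"] by (simp add: sq)
    finally show ?thesis using A tr1 by (simp add: trD)
  qed
  then have cs: "(cmod (mat_trace (?a * D)))\<^sup>2 \<le> s * (frob_norm M2)\<^sup>2"
    using cauchy_schwarz_mat_trace[OF N M2] by (simp add: s_def)
  have "2 * s * ((frob_norm M1)\<^sup>2 + (frob_norm M2)\<^sup>2)
      \<le> (2 * s)\<^sup>2 * (frob_norm A)\<^sup>2 + 2 * (cmod (mat_trace (?a * D)))\<^sup>2"
    using matrix_variance_bound[OF A N L] unfolding sum D_def[symmetric] tD .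
  \<comment> \<open>By \<open>cs\<close> the moment term is at most \<open>2 * s\<close> times the
    squared norm of \<open>M2\<close>, which cancels against the left side.\<close>
  with cs have "2 * s * (frob_norm M1)\<^sup>2 \<le> 2 * s * (2 * (frob_norm A)\<^sup>2 * s)"
    by (simp add: power2_eq_square algebra_simps)
  then have "(frob_norm M1)\<^sup>2 \<le> 2 * (frob_norm A)\<^sup>2 * s"
    using s by (simp only: mult_le_cancel_left_pos mult_pos_pos zero_less_numeral)
  then show ?thesis by (simp add: s_def M1_def)
qed

section \<open>Commutators with unitary conjugates of \<open>A\<close> and of its transpose\<close>

lemma frob_norm_uminus: "A \<in> carrier_mat n m \<Longrightarrow> (frob_norm (- A))\<^sup>2 = (frob_norm A)\<^sup>2"
  by (simp add: frob_norm_square[of _ n m])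

lemma frob_norm_transpose:
  assumes "A \<in> carrier_mat n m"
  shows "(frob_norm (transpose_mat A))\<^sup>2 = (frob_norm A)\<^sup>2"
proof -
  have "(\<Sum>i<m. \<Sum>j<n. (cmod (A $$ (j, i)))\<^sup>2) = (\<Sum>i<n. \<Sum>j<m. (cmod (A $$ (i, j)))\<^sup>2)"
    by (rule sum.swap)
  then show ?thesis
    using assms by (simp add: frob_norm_square[of "transpose_mat A" m n] frob_norm_square[of A n m])
qed

text \<open>The trailing factor \<open>Z\<close> lets these cancellations fire inside
  right-associated products.\<close>

lemma unitary_mat_cancel:
  assumes "unitary_mat n U" "Z \<in> carrier_mat n n"
  shows "mat_adjoint U * (U * Z) = Z" "U * (mat_adjoint U * Z) = Z"
proof -
  note U = unitary_matD[OF assms(1)]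
  have "mat_adjoint U * (U * Z) = mat_adjoint U * U * Z" "U * (mat_adjoint U * Z) = U * mat_adjoint U * Z"
    using U(1) assms(2) by (simp_all add: sq_mat[where n = n])
  then show "mat_adjoint U * (U * Z) = Z" "U * (mat_adjoint U * Z) = Z"
    using U assms(2) by simp_all
qed

lemma frob_norm_unitary_conj:
  assumes "unitary_mat n U" "A \<in> carrier_mat n n"
  shows "(frob_norm (U * A * mat_adjoint U))\<^sup>2 = (frob_norm A)\<^sup>2"
proof -
  note U = unitary_matD[OF assms(1)] and sq = sq_mat[where n = n]
  let ?C = "U * A * mat_adjoint U"
  have C: "?C \<in> carrier_mat n n" using U(1) assms(2) by (simp add: sq)
  have "complex_of_real ((frob_norm ?C)\<^sup>2) = mat_trace (mat_adjoint ?C * ?C)"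
    using frob_norm_square_trace[OF C] by simp
  also have "mat_adjoint ?C * ?C = U * (mat_adjoint A * A * mat_adjoint U)"
    using U(1) assms(2) by (simp add: sq unitary_mat_cancel[OF assms(1)])
  also have "mat_trace \<dots> = mat_trace (mat_adjoint A * A * mat_adjoint U * U)"
    using U(1) assms(2) by (intro mat_trace_mult_comm[of _ n n]) (simp_all add: sq)
  also have "mat_adjoint A * A * mat_adjoint U * U = mat_adjoint A * A"
    using U assms(2) by (simp add: sq)
  also have "mat_trace \<dots> = of_real ((frob_norm A)\<^sup>2)"
    using frob_norm_square_trace[OF assms(2)] by simp
  finally show ?thesis by (simp only: of_real_eq_iff)
qed

lemma unitary_conj_commutator_bound:
  assumes W: "unitary_mat n W" and A: "A \<in> carrier_mat n n" and N: "N \<in> carrier_mat n n"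
  shows "(frob_norm (A * N - N * (W * A * mat_adjoint W)))\<^sup>2 \<le> 2 * (frob_norm A)\<^sup>2 * (frob_norm N)\<^sup>2"
proof -
  note Wc = unitary_matD(1)[OF W] and sq = sq_mat[where n = n] and can = unitary_mat_cancel[OF W]
  define E where "E = mat_adjoint N * N"
  have E: "E \<in> carrier_mat n n" using N by (simp add: E_def sq)
  \<comment> \<open>With this choice \<open>L * mat_adjoint L\<close> is \<open>E\<close> conjugated
    by the adjoint of \<open>W\<close>, so moving \<open>W\<close> around the trace turns moments of
    the conjugate of \<open>A\<close> into moments of \<open>A\<close>.\<close>
  define L where "L = mat_adjoint W * mat_adjoint N"
  have LL: "L * mat_adjoint L = mat_adjoint W * (E * W)"
    using Wc N by (simp add: L_def E_def sq)
  \<comment> \<open>Stated in the right-associated form that \<open>sq\<close> produces, to serve as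
    a rewrite rule at the end.\<close>
  have conj: "mat_trace (W * (Z * (mat_adjoint W * E))) = mat_trace (Z * (mat_adjoint W * (E * W)))"
    if "Z \<in> carrier_mat n n" for Z
    using that Wc E mat_trace_mult_comm[of W n n "Z * (mat_adjoint W * E)"] by (simp add: sq)
  have conj2: "mat_trace (W * (Z * (V * (mat_adjoint W * E)))) = mat_trace (Z * (V * (mat_adjoint W * (E * W))))"
    if "Z \<in> carrier_mat n n" "V \<in> carrier_mat n n" for Z V
    using conj[of "Z * V"] that Wc E by (simp add: sq)
  show ?thesis
  proof (rule intertwiner_norm_bound[of _ n _ _ L])
    show "mat_trace (L * mat_adjoint L) = mat_trace (N * mat_adjoint N)"
      using mat_trace_mult_comm[of "mat_adjoint W" n n "E * W"] mat_trace_mult_comm[of N n n "mat_adjoint N"]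
        Wc E N can unitary_matD(2)[OF W] unfolding LL by (simp add: sq E_def)
  qed (use A N Wc E in \<open>simp_all add: sq can conj conj2 LL flip: E_def, simp_all add: L_def sq\<close>)
qed

lemma unitary_conj_transpose_commutator_bound:
  assumes W: "unitary_mat n W" and A: "A \<in> carrier_mat n n" and N: "N \<in> carrier_mat n n"
  shows "(frob_norm (A * N - N * (W * transpose_mat A * mat_adjoint W)))\<^sup>2
    \<le> 2 * (frob_norm A)\<^sup>2 * (frob_norm N)\<^sup>2"
proof -
  note Wc = unitary_matD(1)[OF W] and sq = sq_mat[where n = n] and can = unitary_mat_cancel[OF W]
  define E where "E = mat_adjoint N * N"
  have E: "E \<in> carrier_mat n n" using N by (simp add: E_def sq)
  \<comment> \<open>Traces are invariant under transposition, which moves the transpose from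
    \<open>A\<close> to the Gram product; hence \<open>L\<close> is itself a transpose.\<close>
  define L where "L = transpose_mat (N * W)"
  have L: "L \<in> carrier_mat n n" using N Wc by (simp add: L_def sq)
  have LL: "L * mat_adjoint L = transpose_mat (mat_adjoint W * (E * W))"
  proof -
    have "transpose_mat (mat_adjoint (N * W) * (N * W)) = L * mat_adjoint L"
      using N Wc unfolding L_def by (subst transpose_mult[of _ n n _ n]) (simp_all add: sq mat_adjoint_transpose)
    then show ?thesis using N Wc by (simp add: E_def sq)
  qed
  have conj: "mat_trace (W * (transpose_mat Z * (mat_adjoint W * E)))
      = mat_trace (Z * transpose_mat (mat_adjoint W * (E * W)))"
    if Z: "Z \<in> carrier_mat n n" for Z
  proof -
    have "mat_trace (W * (transpose_mat Z * (mat_adjoint W * E)))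
        = mat_trace (transpose_mat Z * (mat_adjoint W * (E * W)))"
      using that Wc E mat_trace_mult_comm[of W n n "transpose_mat Z * (mat_adjoint W * E)"] by (simp add: sq)
    also have "\<dots> = mat_trace (transpose_mat (mat_adjoint W * (E * W)) * Z)"
      using that Wc E
      by (subst mat_trace_transpose[of _ n, symmetric], simp add: sq, subst transpose_mult[of _ n n _ n]) (simp_all add: sq)
    also have "\<dots> = mat_trace (Z * transpose_mat (mat_adjoint W * (E * W)))"
      using that Wc E by (intro mat_trace_mult_comm[of _ n n]) (simp_all add: sq)
    finally show ?thesis .
  qed
  \<comment> \<open>Transposition reverses \<open>Z\<close> and \<open>V\<close>, so the two second
    moments trade places. Their sum, which is all that enters \<open>tr2\<close>, is
    unchanged.\<close>
  have conj2: "mat_trace (W * (transpose_mat Z * (transpose_mat V * (mat_adjoint W * E))))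
      = mat_trace (V * (Z * transpose_mat (mat_adjoint W * (E * W))))"
    if "Z \<in> carrier_mat n n" "V \<in> carrier_mat n n" for Z V
    using conj[of "V * Z"] that Wc E by (simp add: sq transpose_mult[of _ n n _ n])
  show ?thesis
  proof (rule intertwiner_norm_bound[of _ n _ _ L])
    show "mat_trace (L * mat_adjoint L) = mat_trace (N * mat_adjoint N)"
      using mat_trace_mult_comm[of "mat_adjoint W" n n "E * W"] mat_trace_mult_comm[of N n n "mat_adjoint N"]
        mat_trace_transpose[of "mat_adjoint W * (E * W)" n]
        Wc E N can unitary_matD(2)[OF W] unfolding LL by (simp add: sq E_def)
  qed (use A N Wc E L in \<open>simp_all add: sq can conj conj2 LL mat_adjoint_transpose add.commute flip: E_def\<close>)
qed

section \<open>Kronecker sums and singular values\<close>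

lemma sum_lessThan_mult_group:
  fixes f :: "nat \<Rightarrow> 'a::comm_monoid_add"
  shows "sum f {..<n * m} = (\<Sum>i<n. \<Sum>j<m. f (i * m + j))"
proof -
  have "sum f {i * m..<i * m + m} = (\<Sum>j<m. f (i * m + j))" for i
    using sum.shift_bounds_nat_ivl[of f 0 "i * m" m] by (simp add: lessThan_atLeast0 add.commute)
  then show ?thesis by (simp flip: sum.nat_group)
qed

lemma mult_add_less: "i * m + j < n * m" if "i < n" "j < m" for i j m n :: nat
proof -
  have "i * m + j < Suc i * m" using that by simp
  also have "\<dots> \<le> n * m" using that by (intro mult_le_mono1) simp
  finally show ?thesis .
qed

lemma kron_mat_index:
  assumes "A \<in> carrier_mat n n" "B \<in> carrier_mat n n" "i < n" "j < n" "k < n" "l < n"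
  shows "kron_mat A B $$ (i * n + j, k * n + l) = A $$ (i, k) * B $$ (j, l)"
  using assms by (auto simp: kron_mat_def mult_add_less)

lemma kron_mat_carrier [simp]:
  "A \<in> carrier_mat n n \<Longrightarrow> B \<in> carrier_mat m m \<Longrightarrow> kron_mat A B \<in> carrier_mat (n * m) (n * m)"
  by (auto simp: kron_mat_def)

text \<open>A column of length \<open>n\<^sup>2\<close> is read row by row as an \<open>n \<times> n\<close> matrix.\<close>

lemma frob_norm_kron_sum_mult:
  fixes A B V :: "complex mat"
  assumes A: "A \<in> carrier_mat n n" and B: "B \<in> carrier_mat n n" and V: "V \<in> carrier_mat (n * n) 1"
  defines "N \<equiv> mat n n (\<lambda>(i, j). V $$ (i * n + j, 0))"
  shows "(frob_norm V)\<^sup>2 = (frob_norm N)\<^sup>2"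
    and "(frob_norm ((kron_mat A (1\<^sub>m n) + kron_mat (1\<^sub>m n) B) * V))\<^sup>2
      = (frob_norm (A * N + N * transpose_mat B))\<^sup>2"
proof -
  let ?X = "kron_mat A (1\<^sub>m n) + kron_mat (1\<^sub>m n) B"
  have N: "N \<in> carrier_mat n n" by (simp add: N_def)
  have X: "?X \<in> carrier_mat (n * n) (n * n)" using A B by simp
  have XV: "?X * V \<in> carrier_mat (n * n) 1" using mult_carrier_mat[OF X V] .
  show "(frob_norm V)\<^sup>2 = (frob_norm N)\<^sup>2"
    unfolding frob_norm_square[OF V] frob_norm_square[OF N] by (simp add: N_def sum_lessThan_mult_group)
  have M: "A * N + N * transpose_mat B \<in> carrier_mat n n" using A B N by (simp add: sq_mat[where n = n])
  have "(?X * V) $$ (i * n + j, 0) = (A * N + N * transpose_mat B) $$ (i, j)" if ij: "i < n" "j < n" for i j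
  proof -
    have "(?X * V) $$ (i * n + j, 0) = (\<Sum>c<n * n. ?X $$ (i * n + j, c) * V $$ (c, 0))"
      using X V ij by (intro mult_mat_index[of _ "n * n" "n * n" _ 1]) (auto simp: mult_add_less)
    also have "\<dots> = (\<Sum>k<n. \<Sum>l<n. ?X $$ (i * n + j, k * n + l) * N $$ (k, l))"
      by (simp add: sum_lessThan_mult_group N_def)
    \<comment> \<open>Each identity factor becomes a Kronecker delta that later removes one of the
      two summations.\<close>
    also have "\<dots> = (\<Sum>k<n. \<Sum>l<n. (A $$ (i, k) * (if j = l then 1 else 0) + (if i = k then 1 else 0) * B $$ (j, l)) * N $$ (k, l))"
    proof (intro sum.cong refl)
      fix k l assume kl: "k \<in> {..<n}" "l \<in> {..<n}"
      have "?X $$ (i * n + j, k * n + l) = kron_mat A (1\<^sub>m n) $$ (i * n + j, k * n + l) + kron_mat (1\<^sub>m n) B $$ (i * n + j, k * n + l)"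
        using ij kl B by (intro index_add_mat) (auto simp: kron_mat_def mult_add_less)
      also have "\<dots> = A $$ (i, k) * (if j = l then 1 else 0) + (if i = k then 1 else 0) * B $$ (j, l)"
        using A B ij kl by (simp add: kron_mat_index)
      finally show "?X $$ (i * n + j, k * n + l) * N $$ (k, l)
        = (A $$ (i, k) * (if j = l then 1 else 0) + (if i = k then 1 else 0) * B $$ (j, l)) * N $$ (k, l)"
        by simp
    qed
    also have "\<dots> = (\<Sum>k<n. \<Sum>l<n. (if j = l then A $$ (i, k) * N $$ (k, l) else 0)
        + (if i = k then N $$ (k, l) * B $$ (j, l) else 0))"
      by (intro sum.cong refl) (auto simp: distrib_right)
    also have "\<dots> = (\<Sum>k<n. A $$ (i, k) * N $$ (k, j))
        + (\<Sum>l<n. \<Sum>k<n. if i = k then N $$ (k, l) * B $$ (j, l) else 0)"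
      unfolding sum.distrib using ij
      by (subst sum.swap[of "\<lambda>k l. if i = k then N $$ (k, l) * B $$ (j, l) else 0"]) simp
    also have "(\<Sum>l<n. \<Sum>k<n. if i = k then N $$ (k, l) * B $$ (j, l) else 0) = (\<Sum>l<n. N $$ (i, l) * B $$ (j, l))"
      using ij by simp
    also have "(\<Sum>k<n. A $$ (i, k) * N $$ (k, j)) + \<dots> = (A * N) $$ (i, j) + (N * transpose_mat B) $$ (i, j)"
      using A B N ij by (simp add: mult_mat_index[of _ n n _ n] del: index_mult_mat)
    also have "\<dots> = (A * N + N * transpose_mat B) $$ (i, j)"
      using A B N ij by simp
    finally show ?thesis .
  qed
  then show "(frob_norm (?X * V))\<^sup>2 = (frob_norm (A * N + N * transpose_mat B))\<^sup>2"
    unfolding frob_norm_square[OF XV] frob_norm_square[OF M] by (simp add: sum_lessThan_mult_group del: index_mult_mat)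
qed

section \<open>Singular values and norm bounds\<close>

lemma length_singular_values:
  assumes "X \<in> carrier_mat n m"
  shows "length (singular_values X) = m"
proof -
  have "mat_adjoint X * X \<in> carrier_mat m m" using assms by auto
  from degree_monic_char_poly[OF this] have "size (proots (char_poly (mat_adjoint X * X))) = m"
    by (simp add: size_proots_complex)
  then show ?thesis by (simp add: singular_values_def flip: size_mset)
qed

text \<open>On an eigenvector of \<open>mat_adjoint X * X\<close> the matrix \<open>X\<close> scales
  the squared norm by exactly the eigenvalue. Vectors are one-column matrices, so that
  \<open>frob_norm\<close> is their Euclidean norm.\<close>

lemma singular_value_square_le:
  assumes X: "X \<in> carrier_mat n m"
    and bound: "\<And>V. V \<in> carrier_mat m 1 \<Longrightarrow> (frob_norm (X * V))\<^sup>2 \<le> c * (frob_norm V)\<^sup>2"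
    and s: "s \<in> set (singular_values X)"
  shows "s\<^sup>2 \<le> c"
proof -
  have XX: "mat_adjoint X * X \<in> carrier_mat m m" using X by (intro mult_carrier_mat) auto
  have "char_poly (mat_adjoint X * X) \<noteq> 0" using degree_monic_char_poly[OF XX] by auto
  then obtain z where z: "poly (char_poly (mat_adjoint X * X)) z = 0" "s = sqrt (Re z)"
    using s by (auto simp: singular_values_def)
  then have "eigenvalue (mat_adjoint X * X) z" using eigenvalue_root_char_poly[OF XX] by simp
  then obtain v where v: "v \<in> carrier_vec m" "v \<noteq> 0\<^sub>v m" "(mat_adjoint X * X) *\<^sub>v v = z \<cdot>\<^sub>v v"
    using X by (auto simp: eigenvalue_def eigenvector_def)
  define V where "V = mat_of_cols m [v]"
  have V: "V \<in> carrier_mat m 1" using mat_of_cols_carrier(1)[of m "[v]"] by (simp add: V_def)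
  have XV: "X * V \<in> carrier_mat n 1" using mult_carrier_mat[OF X V] .
  have eig: "mat_adjoint X * X * V = z \<cdot>\<^sub>m V"
  proof (rule eq_matI)
    fix i j assume ij: "i < dim_row (z \<cdot>\<^sub>m V)" "j < dim_col (z \<cdot>\<^sub>m V)"
    then have "(mat_adjoint X * X * V) $$ (i, j) = ((mat_adjoint X * X) *\<^sub>v v) $ i"
      using V mat_of_cols_carrier(1)[of m "[v]"] X XX v(1) by (subst index_mult_mat) (simp_all add: V_def)
    then show "(mat_adjoint X * X * V) $$ (i, j) = (z \<cdot>\<^sub>m V) $$ (i, j)"
      using v ij V by (simp add: V_def mat_of_cols_def)
  qed (use V XX in auto)
  have "complex_of_real ((frob_norm (X * V))\<^sup>2) = mat_trace (mat_adjoint (X * V) * (X * V))"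
    using frob_norm_square_trace[OF XV] by simp
  also have "mat_adjoint (X * V) * (X * V) = mat_adjoint V * (mat_adjoint X * X * V)"
  proof -
    have "mat_adjoint (X * V) * (X * V) = mat_adjoint V * (mat_adjoint X * (X * V))"
      using X V XV by (simp add: mat_adjoint_mult[OF X V] assoc_mult_mat[of _ 1 m _ n _ 1])
    then show ?thesis using X V by (simp add: assoc_mult_mat[of _ m n _ m _ 1])
  qed
  also have "mat_trace \<dots> = z * mat_trace (mat_adjoint V * V)"
    unfolding eig using V
    by (simp add: mat_trace_adjoint_mult_eq[of _ m 1] sum_distrib_left mult_ac)
  also have "\<dots> = z * of_real ((frob_norm V)\<^sup>2)" using frob_norm_square_trace[OF V] by simp
  \<comment> \<open>Real parts suffice, since a singular value is defined from
    \<open>Re z\<close>.\<close>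
  finally have "Re (complex_of_real ((frob_norm (X * V))\<^sup>2)) = Re (z * of_real ((frob_norm V)\<^sup>2))" by simp
  then have eq: "(frob_norm (X * V))\<^sup>2 = Re z * (frob_norm V)\<^sup>2" by simp
  have "frob_norm V \<noteq> 0"
  proof
    assume "frob_norm V = 0"
    then have V0: "V = 0\<^sub>m m 1" using frob_norm_eq_0[OF V] by simp
    have "v = col V 0" using v(1) by (simp add: V_def)
    then show False using v(2) V0 by simp
  qed
  then have pos: "0 < (frob_norm V)\<^sup>2" by simp
  \<comment> \<open>The sign matters: \<open>sqrt\<close> of a negative real is a negative real, so
    squaring gives back \<open>Re z\<close> only if it is nonnegative.\<close>
  have "0 \<le> Re z * (frob_norm V)\<^sup>2" unfolding eq[symmetric] by simp
  then have "0 \<le> Re z" using pos by (simp add: zero_le_mult_iff)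
  moreover have "Re z \<le> c" using bound[OF V] pos unfolding eq by simp
  ultimately show ?thesis using z(2) by simp
qed

theorem theorem2:
  fixes A B :: "complex mat"
  assumes "A \<in> carrier_mat 4 4" and "B \<in> carrier_mat 4 4"
    and "mat_trace A = 0" and "mat_trace B = 0"
    and "(frob_norm A)\<^sup>2 + (frob_norm B)\<^sup>2 = 1/4"
    and "\<exists>U. unitary_mat 4 U \<and>
           (B = - (U * transpose_mat A * mat_adjoint U) \<or> B = - (U * A * mat_adjoint U))"
  shows "(let X = kron_mat A (1\<^sub>m 4) + kron_mat (1\<^sub>m 4) B
          in (sigma X 1)\<^sup>2 + (sigma X 2)\<^sup>2 \<le> 1/2)"
proof -
  note A = assms(1) and B = assms(2) and sq = sq_mat[where n = 4]
  define X where "X = kron_mat A (1\<^sub>m 4) + kron_mat (1\<^sub>m 4) B"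
  have X: "X \<in> carrier_mat (4 * 4) (4 * 4)" unfolding X_def using A B by (intro add_carrier_mat kron_mat_carrier) auto
  from assms(6) obtain U where U: "unitary_mat 4 U" and
    B_eq: "B = - (U * transpose_mat A * mat_adjoint U) \<or> B = - (U * A * mat_adjoint U)" by blast
  note Uc = unitary_matD(1)[OF U]
  \<comment> \<open>\<open>W\<close> is the entrywise conjugate of \<open>U\<close>; transposing a
    conjugation by \<open>U\<close> gives a conjugation by \<open>W\<close>.\<close>
  define W where "W = transpose_mat (mat_adjoint U)"
  have W: "unitary_mat 4 W" unfolding W_def using U by (intro unitary_mat_transpose unitary_mat_adjoint)
  have Wa: "mat_adjoint W = transpose_mat U" by (simp add: W_def mat_adjoint_transpose)
  have tr_conj: "transpose_mat (- (U * Z * mat_adjoint U)) = - (W * transpose_mat Z * mat_adjoint W)"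
    if "Z \<in> carrier_mat 4 4" for Z
  proof -
    have "transpose_mat (U * Z * mat_adjoint U) = W * transpose_mat Z * mat_adjoint W"
      using that Uc unfolding Wa by (simp add: W_def sq transpose_mult[of _ 4 4 _ 4])
    moreover have "transpose_mat (- Z) = - transpose_mat Z" for Z :: "complex mat"
      by (rule eq_matI) auto
    ultimately show ?thesis by simp
  qed
  have "(frob_norm B)\<^sup>2 = (frob_norm A)\<^sup>2"
  proof -
    have "U * Z * mat_adjoint U \<in> carrier_mat 4 4" if "Z \<in> carrier_mat 4 4" for Z
      using that Uc by (simp add: sq)
    then show ?thesis using B_eq A
      by (auto simp: frob_norm_uminus[of _ 4 4] frob_norm_unitary_conj[OF U] frob_norm_transpose[of _ 4 4])
  qed
  \<comment> \<open>The two squared norms are equal, hence 1/8 each, and the constant in the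
    commutator bounds becomes 1/4.\<close>
  then have fA: "2 * (frob_norm A)\<^sup>2 = 1/4" using assms(5) by simp
  have bound: "(frob_norm (A * N + N * transpose_mat B))\<^sup>2 \<le> 1/4 * (frob_norm N)\<^sup>2"
    if N: "N \<in> carrier_mat 4 4" for N
  proof -
    have add: "A * N + N * - F = A * N - N * F" if F: "F \<in> carrier_mat 4 4" for F
      using A N F by (intro eq_matI) auto
    \<comment> \<open>Transposing exchanges the alternatives: the transpose of \<open>A\<close> in
      \<open>B\<close> becomes \<open>A\<close>, and conversely.\<close>
    from B_eq have "transpose_mat B = - (W * A * mat_adjoint W) \<or> transpose_mat B = - (W * transpose_mat A * mat_adjoint W)"
      using A tr_conj[of A] tr_conj[of "transpose_mat A"] by auto
    then show ?thesis
      using unitary_conj_commutator_bound[OF W A N] unitary_conj_transpose_commutator_bound[OF W A N]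
        add unitary_matD(1)[OF W] A unfolding fA by (auto simp: sq)
  qed
  have sv: "s\<^sup>2 \<le> 1/4" if "s \<in> set (singular_values X)" for s
  proof (rule singular_value_square_le[OF X _ that])
    fix V :: "complex mat" assume V: "V \<in> carrier_mat (4 * 4) 1"
    show "(frob_norm (X * V))\<^sup>2 \<le> 1/4 * (frob_norm V)\<^sup>2"
      unfolding X_def frob_norm_kron_sum_mult[OF A B V] by (rule bound) simp
  qed
  \<comment> \<open>The list has length 16, so the positions 0 and 1 read by \<open>sigma\<close>
    hold actual singular values.\<close>
  have "(sigma X 1)\<^sup>2 \<le> 1/4" "(sigma X 2)\<^sup>2 \<le> 1/4"
    unfolding sigma_def using length_singular_values[OF X] by (simp_all only: sv[OF nth_mem])
  then have "(sigma X 1)\<^sup>2 + (sigma X 2)\<^sup>2 \<le> 1/2" by linarith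
  then show ?thesis by (simp add: X_def Let_def)
qed

end
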